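(* Let $E$ and $F$ be finite sets and let $\mathsf{A}$ be a bimatroid on the ground set $E\times F$. Set $m=|E|$, $n=|F|$ and $m\wedge n=\min\{m,n\}$. For $k\geq 0$ let $R_k(\mathsf{A})$ denote the number of regular minors $(I,J)$ of $\mathsf{A}$ with $|I|=|J|=k$. Then the sequence $R_k(\mathsf{A})$ is ultra log-concave, i.e. \[ \frac{R_k(\mathsf{A})^2}{\binom{m\wedge n}{k}^2}\geq \frac{R_{k+1}(\mathsf{A})}{\binom{m\wedge n}{k+1}}\cdot \frac{R_{k-1}(\mathsf{A})}{\binom{m\wedge n}{k-1}} \] for all $k\geq 1$.
   Context: For finite sets $E,F$ write $\binom{E}{\ast}\times\binom{F}{\ast}=\bigcup_{d\ge 0}\binom{E}{d}\times\binom{F}{d}$, where $\binom{S}{d}$ is the set of $d$-element subsets of $S$. For sets $S$ and $s\in S$, $s'\notin S$, write $S_{s\leftrightarrow s'}=(S-\{s\})\cup\{s'\}$. A bimatroid $\mathsf{A}$ on $E\times F$ is a subset $\mathcal{R}(\mathsf{A})\subseteq\binom{E}{\ast}\times\binom{F}{\ast}$ (the regular minors) such that: (1) $(\emptyset,\emptyset)\in\mathcal{R}(\mathsf{A})$; (2) for all $(I,J),(I',J')\in\mathcal{R}(\mathsf{A})$: (a) for every $i'\in I'-I$, either there is $i\in I-I'$ with $(I_{i\leftrightarrow i'},J)\in\mathcal{R}(\mathsf{A})$, or there is $j'\in J'-J$ with $(I\cup\{i'\},J\cup\{j'\})\in\mathcal{R}(\mathsf{A})$; (b) for every $j\in J-J'$,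 either there is $j'\in J'-J$ with $(I,J_{j\leftrightarrow j'})\in\mathcal{R}(\mathsf{A})$, or there is $i\in I-I'$ with $(I-\{i\},J-\{j\})\in\mathcal{R}(\mathsf{A})$. (Example: the pairs $(I,J)$ with $\det A_{I,J}\neq 0$ for a matrix $A\in\mathbb{K}^{E\times F}$.) *)

theory Defs
  imports Complex_Main "HOL-Library.Ramsey"
begin

definition exchange :: "'a set \<Rightarrow> 'a \<Rightarrow> 'a \<Rightarrow> 'a set" where
  "exchange S s s' = (S - {s}) \<union> {s'}"

(* [E]^d is the library's set of d-element subsets of E. *)
definition equicard_pairs :: "'a set \<Rightarrow> 'b set \<Rightarrow> ('a set \<times> 'b set) set" where
  "equicard_pairs E F = (\<Union>d::nat. [E]\<^bsup>d\<^esup> \<times> [F]\<^bsup>d\<^esup>)"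

(* A bimatroid is identified with its set R of regular minors. Rows and columns may have
   different types; no disjointness of E and F is required when the types agree. *)
definition bimatroid :: "'a set \<Rightarrow> 'b set \<Rightarrow> ('a set \<times> 'b set) set \<Rightarrow> bool" where
  "bimatroid E F R \<longleftrightarrow>
     R \<subseteq> equicard_pairs E F \<and>
     ({}, {}) \<in> R \<and>
     (\<forall>I J I' J'. (I, J) \<in> R \<longrightarrow> (I', J') \<in> R \<longrightarrow>
        (\<forall>i' \<in> I' - I.
           (\<exists>i \<in> I - I'. (exchange I i i', J) \<in> R) \<or>
           (\<exists>j' \<in> J' - J. (I \<union> {i'}, J \<union> {j'}) \<in> R)) \<and>
        (\<forall>j \<in> J - J'.
           (\<exists>j' \<in> J' - J. (I, exchange J j j') \<in> R) \<or>
           (\<exists>i \<in> I - I'. (I - {i}, J - {j}) \<in> R)))"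

definition num_regular_minors :: "('a set \<times> 'b set) set \<Rightarrow> nat \<Rightarrow> nat" where
  "num_regular_minors R k = card {(I, J). (I, J) \<in> R \<and> card I = k \<and> card J = k}"

end

theory Submission
  imports Defs "HOL-Analysis.Function_Topology"
begin

text \<open>
  The sets \<open>(E - I) \<union> J\<close> with \<open>(I, J)\<close> a regular minor are the bases of a matroid of rank \<open>m\<close> on
  the disjoint union of \<open>E\<close> and \<open>F\<close>, and the complements \<open>I \<union> (F - J)\<close> are the bases of its dual,
  of rank \<open>n\<close>. It thus suffices to show, for a matroid of rank \<open>d\<close> and a subset \<open>Q\<close> of its ground
  set, that the number of bases meeting \<open>Q\<close> in \<open>k\<close> elements is ultra log-concave with respect to
  \<open>d choose k\<close>. Up to factorials these numbers are iterated directional derivatives of the basis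
  generating polynomial along the indicators of \<open>Q\<close> and of its complement, so the claim is an
  Alexandrov--Fenchel inequality for such derivatives. Perturbing the indicators, the directions
  may be taken positive.

  Let \<open>H\<close> be the symmetric matrix remaining after differentiating along all but two positive
  directions. One proves that its form is nonpositive on a hyperplane by induction on the rank.
  If \<open>w\<close> is one of the directions, then \<open>H\<close> is the sum of the \<open>w i * H\<^sub>i\<close> with \<open>H\<^sub>i\<close>
  belonging to the contraction by \<open>i\<close>, and \<open>H\<^sub>i w\<close> is the \<open>i\<close>-th row of \<open>H\<close>. The inequality for
  \<open>H\<^sub>i\<close> says that the operator \<open>A = D\<^sup>-\<^sup>1 H\<close>, with \<open>D\<close> the diagonal matrix of entries
  \<open>(H w) i / w i\<close>, satisfies \<open>\<langle>v, A v\<rangle> \<le> \<langle>A v, A v\<rangle>\<close> in the inner product defined by \<open>D\<close>, so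
  each eigenvalue of \<open>A\<close> is \<open>\<le> 0\<close> or \<open>\<ge> 1\<close>. By the Perron--Frobenius argument for \<open>A w = w\<close>,
  the eigenvalue \<open>1\<close> is simple and the largest one.
\<close>

section \<open>Symmetric forms that are nonpositive on a hyperplane\<close>

text \<open>In the product topology, Tychonoff gives compactness once the coordinates outside
  \<open>N\<close> are pinned to 0; \<open>cong\<close> carries the maximum back to arbitrary
  functions.\<close>

lemma compact_max_on_slice:
  fixes c l :: "'a \<Rightarrow> real" and f :: "('a \<Rightarrow> real) \<Rightarrow> real"
  assumes fin: "finite N" and c: "\<And>i. i \<in> N \<Longrightarrow> c i > 0"
    and cont: "continuous_on UNIV f"
    and ex: "\<exists>v. (\<Sum>i\<in>N. c i * (v i)\<^sup>2) = 1 \<and> (\<Sum>i\<in>N. l i * v i) = 0"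
    and cong: "\<And>u v. (\<And>i. i \<in> N \<Longrightarrow> u i = v i) \<Longrightarrow> f u = f v"
  obtains v where "(\<Sum>i\<in>N. c i * (v i)\<^sup>2) = 1" "(\<Sum>i\<in>N. l i * v i) = 0"
    "\<And>u. (\<Sum>i\<in>N. c i * (u i)\<^sup>2) = 1 \<Longrightarrow> (\<Sum>i\<in>N. l i * u i) = 0 \<Longrightarrow> f u \<le> f v"
proof -
  \<comment> \<open>The constraint bounds \<open>(u i)\<^sup>2\<close> by \<open>1 / c i\<close>,
    and a number is at most 1 plus its square, so no square roots are needed.\<close>
  define S where "S = (\<lambda>i. if i \<in> N then {- (1 + 1 / c i) .. 1 + 1 / c i} else {0})"
  define K where "K = PiE UNIV S \<inter> {v. (\<Sum>i\<in>N. c i * (v i)\<^sup>2) = 1} \<inter> {v. (\<Sum>i\<in>N. l i * v i) = 0}"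
  have "compactin (product_topology (\<lambda>_. euclidean) UNIV) (PiE UNIV S)"
    unfolding compactin_PiE by (simp add: S_def)
  then have "compact (PiE UNIV S)"
    by (simp add: euclidean_product_topology)
  moreover have "closed {v. (\<Sum>i\<in>N. c i * (v i)\<^sup>2) = 1}"
    by (intro closed_Collect_eq continuous_intros) simp
  moreover have "closed {v. (\<Sum>i\<in>N. l i * v i) = 0}"
    by (intro closed_Collect_eq continuous_intros) simp
  ultimately have compact: "compact K"
    unfolding K_def by (intro compact_Int_closed)
  have restr: "(\<lambda>i. if i \<in> N then u i else 0) \<in> K"
    if u: "(\<Sum>i\<in>N. c i * (u i)\<^sup>2) = 1" "(\<Sum>i\<in>N. l i * u i) = 0" for u
  proof -
    have "u i \<in> S i" if i: "i \<in> N" for i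
    proof -
      have "c i * (u i)\<^sup>2 \<le> (\<Sum>i\<in>N. c i * (u i)\<^sup>2)"
        using c fin i by (intro member_le_sum) (auto simp: less_imp_le)
      then have "(u i)\<^sup>2 \<le> 1 / c i"
        using u c[OF i] by (simp add: field_simps)
      moreover have "\<bar>u i\<bar> \<le> 1 + (u i)\<^sup>2"
        using sum_squares_bound[of 1 "\<bar>u i\<bar>"] by (simp add: power2_eq_square)
      ultimately have "u i \<le> 1 + 1 / c i" "- (1 + 1 / c i) \<le> u i"
        by linarith+
      then show ?thesis using i by (simp add: S_def)
    qed
    then show ?thesis
      using u by (auto simp: K_def) (simp add: S_def)
  qed
  have "K \<noteq> {}" using ex restr by blast
  then obtain v where v: "v \<in> K" "\<And>u. u \<in> K \<Longrightarrow> f u \<le> f v"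
    using continuous_attains_sup[OF compact] cont continuous_on_subset by blast
  show thesis
  proof (rule that[of v])
    fix u assume "(\<Sum>i\<in>N. c i * (u i)\<^sup>2) = 1" "(\<Sum>i\<in>N. l i * u i) = 0"
    then have "f (\<lambda>i. if i \<in> N then u i else 0) \<le> f v"
      by (intro v(2) restr)
    then show "f u \<le> f v"
      using cong[of "\<lambda>i. if i \<in> N then u i else 0" u] by simp
  qed (use v(1) in \<open>auto simp: K_def\<close>)
qed

text \<open>For small \<open>t\<close> the linear term dominates, hence it vanishes: the first-order
  condition at a maximum.\<close>

lemma linear_coeff_zero:
  fixes a b :: real
  assumes "\<And>t. 2 * t * a + t\<^sup>2 * b \<le> 0"
  shows "a = 0"
proof (rule ccontr)
  assume "a \<noteq> 0"
  define t where "t = a / (1 + \<bar>b\<bar>)"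
  have "t * (1 + \<bar>b\<bar>) = a" by (simp add: t_def add_nonneg_eq_0_iff)
  moreover have "t \<noteq> 0" using \<open>a \<noteq> 0\<close> by (auto simp: t_def)
  ultimately have "2 * t * a + t\<^sup>2 * b = t\<^sup>2 * (2 + 2 * \<bar>b\<bar> + b)"
    by (auto simp: algebra_simps power2_eq_square)
  moreover have "t\<^sup>2 * (2 + 2 * \<bar>b\<bar> + b) > 0"
    using \<open>t \<noteq> 0\<close> by (intro mult_pos_pos) auto
  ultimately show False using assms[of t] by linarith
qed

definition bil :: "'a set \<Rightarrow> ('a \<Rightarrow> 'a \<Rightarrow> real) \<Rightarrow> ('a \<Rightarrow> real) \<Rightarrow> ('a \<Rightarrow> real) \<Rightarrow> real" where
  "bil N H u v = (\<Sum>i\<in>N. \<Sum>j\<in>N. u i * H i j * v j)"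

lemma bil_add_scaled:
  "bil N H (\<lambda>i. u i + t * v i) z = bil N H u z + t * bil N H v z"
  "bil N H z (\<lambda>i. u i + t * v i) = bil N H z u + t * bil N H z v"
  unfolding bil_def by (simp_all add: algebra_simps sum.distrib sum_distrib_left)

lemma bil_sym:
  assumes "\<And>i j. H i j = H j i"
  shows "bil N H u v = bil N H v u"
  unfolding bil_def by (subst sum.swap) (simp add: assms[of _ "_"] mult_ac)

lemma bil_eq: "bil N H u v = (\<Sum>i\<in>N. u i * (\<Sum>j\<in>N. H i j * v j))"
  unfolding bil_def by (simp add: sum_distrib_left mult_ac)

lemma bil_mono_neutral:
  assumes "finite S" "N \<subseteq> S"
    and z: "\<And>i j. i \<in> S \<Longrightarrow> j \<in> S \<Longrightarrow> i \<notin> N \<or> j \<notin> N \<Longrightarrow> H i j = 0"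
  shows "bil S H u v = bil N H u v"
proof -
  have "bil S H u v = (\<Sum>i\<in>N. \<Sum>j\<in>S. u i * H i j * v j)"
    unfolding bil_def using assms z by (intro sum.mono_neutral_right) auto
  also have "\<dots> = bil N H u v"
    unfolding bil_def using assms z by (intro sum.cong refl sum.mono_neutral_right) auto
  finally show ?thesis .
qed

text \<open>Adding a suitable multiple of \<open>w\<close> moves \<open>v\<close> into the
  hyperplane, where the form is nonpositive; completing the square gives the discriminant
  inequality.\<close>

lemma reverse_cauchy_schwarz:
  assumes sym: "\<And>i j. H i j = H j i"
    and neg: "\<And>v. (\<Sum>i\<in>N. l i * v i) = 0 \<Longrightarrow> bil N H v v \<le> 0"
    and w: "bil N H w w > 0"
  shows "bil N H v v * bil N H w w \<le> (bil N H v w)\<^sup>2"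
proof -
  define L where "L v = (\<Sum>i\<in>N. l i * v i)" for v
  have "L w \<noteq> 0" using neg[of w] w by (auto simp: L_def)
  define c where "c = - (L v / L w)"
  define z where "z = (\<lambda>i. v i + c * w i)"
  have "L z = L v + c * L w"
    by (simp add: L_def z_def algebra_simps sum.distrib sum_distrib_left)
  then have "L z = 0" using \<open>L w \<noteq> 0\<close> by (simp add: c_def)
  then have "bil N H z z \<le> 0" using neg[of z] by (simp add: L_def)
  then have "bil N H z z * bil N H w w \<le> 0"
    using w by (simp add: mult_nonpos_nonneg)
  moreover have "bil N H w v = bil N H v w" by (rule bil_sym[OF sym])
  ultimately have "(bil N H v v + 2 * c * bil N H v w + c\<^sup>2 * bil N H w w) * bil N H w w \<le> 0"
    unfolding z_def by (simp add: bil_add_scaled algebra_simps power2_eq_square)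
  moreover have "(bil N H v w + c * bil N H w w)\<^sup>2 \<ge> 0" by simp
  ultimately show ?thesis by (simp add: algebra_simps power2_eq_square)
qed

lemma bil_scale: "bil N H (\<lambda>i. t * u i) (\<lambda>i. t * u i) = t\<^sup>2 * bil N H u u"
  unfolding bil_def by (simp add: sum_distrib_left power2_eq_square mult_ac)

text \<open>In the inner product with weights \<open>c i = h i / w i\<close>, the hyperplane is the
  complement of \<open>w\<close>, and the right side of \<open>hyp\<close> is the squared norm of
  \<open>A v\<close>. A positive maximum on the unit sphere of the hyperplane is an eigenvalue of
  \<open>A\<close>; \<open>hyp\<close> makes it at least 1, and the irreducibility condition
  \<open>conn\<close> then forces the maximiser to be a multiple of \<open>w\<close>.\<close>

lemma bil_nonpos_on_hyperplane:
  fixes H :: "'a \<Rightarrow> 'a \<Rightarrow> real"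
  assumes fin: "finite N"
    and sym: "\<And>i j. H i j = H j i"
    and nonneg: "\<And>i j. H i j \<ge> 0"
    and w: "\<And>i. i \<in> N \<Longrightarrow> w i > 0"
    and h: "\<And>i. i \<in> N \<Longrightarrow> h i = (\<Sum>j\<in>N. H i j * w j)"
    and hpos: "\<And>i. i \<in> N \<Longrightarrow> h i > 0"
    and conn: "\<And>i j. i \<in> N \<Longrightarrow> j \<in> N \<Longrightarrow> i \<noteq> j \<Longrightarrow> H i j > 0 \<or> (\<exists>k\<in>N. H i k > 0 \<and> H j k > 0)"
    and hyp: "\<And>v. bil N H v v \<le> (\<Sum>i\<in>N. w i * (\<Sum>j\<in>N. H i j * v j)\<^sup>2 / h i)"
    and v: "(\<Sum>i\<in>N. h i * v i) = 0"
  shows "bil N H v v \<le> 0"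
proof (rule ccontr)
  assume "\<not> bil N H v v \<le> 0"
  then have qv: "bil N H v v > 0" by simp
  define c where "c i = h i / w i" for i
  have c: "c i > 0" if "i \<in> N" for i using w hpos that by (simp add: c_def)
  define n where "n u = (\<Sum>i\<in>N. c i * (u i)\<^sup>2)" for u
  have n_nonneg: "n u \<ge> 0" for u
    unfolding n_def using c by (intro sum_nonneg mult_nonneg_nonneg) (auto simp: less_imp_le)
  have n_eq_0: "n u = 0 \<longleftrightarrow> (\<forall>i\<in>N. u i = 0)" for u
    unfolding n_def using fin c by (subst sum_nonneg_eq_0_iff) (fastforce simp: less_imp_le)+
  have n_scale: "n (\<lambda>i. t * u i) = t\<^sup>2 * n u" for t u
    by (simp add: n_def sum_distrib_left power_mult_distrib mult_ac)
  have normalize: "n (\<lambda>i. (1 / sqrt (n u)) * u i) = 1" if "n u \<noteq> 0" for u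
    unfolding n_scale using that n_nonneg[of u] by (simp add: power_divide)
  have "n v \<noteq> 0"
  proof
    assume "n v = 0"
    then have "\<forall>i\<in>N. v i = 0" by (simp add: n_eq_0)
    then have "bil N H v v = 0" by (simp add: bil_def)
    with qv show False by simp
  qed
  have L_scale: "(\<Sum>i\<in>N. h i * (t * u i)) = t * (\<Sum>i\<in>N. h i * u i)" for t u
    by (simp add: sum_distrib_left mult_ac)
  have ex: "\<exists>u. (\<Sum>i\<in>N. c i * (u i)\<^sup>2) = 1 \<and> (\<Sum>i\<in>N. h i * u i) = 0"
    using normalize[OF \<open>n v \<noteq> 0\<close>] L_scale[of "1 / sqrt (n v)" v] v
    by (intro exI[of _ "\<lambda>i. (1 / sqrt (n v)) * v i"]) (simp add: n_def)
  have cont: "continuous_on UNIV (\<lambda>u. bil N H u u)"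
    unfolding bil_def by (intro continuous_intros) simp_all
  obtain x where x: "n x = 1" "(\<Sum>i\<in>N. h i * x i) = 0"
    and x_max: "\<And>u. n u = 1 \<Longrightarrow> (\<Sum>i\<in>N. h i * u i) = 0 \<Longrightarrow> bil N H u u \<le> bil N H x x"
    using compact_max_on_slice[of N c "\<lambda>u. bil N H u u" h thesis, OF fin c cont ex]
    unfolding n_def by (auto simp: bil_def)
  define lam where "lam = bil N H x x"
  have max: "bil N H u u \<le> lam * n u" if "(\<Sum>i\<in>N. h i * u i) = 0" for u
  proof (cases "n u = 0")
    case True
    then have "bil N H u u = 0" by (simp add: n_eq_0 bil_def)
    with True show ?thesis by simp
  next
    case False
    have "bil N H (\<lambda>i. (1 / sqrt (n u)) * u i) (\<lambda>i. (1 / sqrt (n u)) * u i) \<le> lam"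
      unfolding lam_def using that L_scale[of "1 / sqrt (n u)" u] 
      by (intro x_max normalize[OF False]) simp
    then show ?thesis
      unfolding bil_scale using False n_nonneg[of u] by (simp add: power_divide field_simps)
  qed
  have "lam > 0" using max[OF v] qv n_nonneg[of v] \<open>n v \<noteq> 0\<close>
    by (metis less_le_trans mult_nonpos_nonneg not_less)
  (* y = A x - lam x, to be shown to vanish by the first-order condition at the maximiser x *)
  define y where "y i = w i * (\<Sum>j\<in>N. H i j * x j) / h i + (- lam) * x i" for i
  \<comment> \<open>\<open>A\<close> is selfadjoint and fixes \<open>w\<close>, so \<open>y\<close>
    stays in the hyperplane and \<open>x + t * y\<close> is an admissible variation.\<close>
  have y0: "(\<Sum>i\<in>N. h i * y i) = 0"
  proof -
    have "(\<Sum>i\<in>N. h i * y i) = (\<Sum>i\<in>N. w i * (\<Sum>j\<in>N. H i j * x j) - lam * (h i * x i))"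
      using hpos by (intro sum.cong) (auto simp: y_def field_simps dest!: hpos)
    also have "\<dots> = bil N H w x - lam * (\<Sum>i\<in>N. h i * x i)"
      by (simp add: bil_eq sum_subtractf sum_distrib_left)
    also have "bil N H w x = bil N H x w" by (rule bil_sym[OF sym])
    also have "\<dots> = (\<Sum>i\<in>N. h i * x i)" using h by (simp add: bil_eq mult.commute)
    finally show ?thesis using x by simp
  qed
  have "2 * t * (bil N H y x - lam * (\<Sum>i\<in>N. c i * y i * x i)) + t\<^sup>2 * (bil N H y y - lam * n y) \<le> 0" for t
  proof -
    have "(\<Sum>i\<in>N. h i * (x i + t * y i)) = (\<Sum>i\<in>N. h i * x i) + t * (\<Sum>i\<in>N. h i * y i)"
      by (simp add: algebra_simps sum.distrib sum_distrib_left)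
    then have "bil N H (\<lambda>i. x i + t * y i) (\<lambda>i. x i + t * y i) \<le> lam * n (\<lambda>i. x i + t * y i)"
      using x y0 by (intro max) simp
    moreover have "n (\<lambda>i. x i + t * y i) = n x + 2 * t * (\<Sum>i\<in>N. c i * y i * x i) + t\<^sup>2 * n y"
      by (simp add: n_def algebra_simps sum.distrib sum_distrib_left power2_eq_square)
    moreover have "bil N H x y = bil N H y x" by (rule bil_sym[OF sym])
    ultimately show ?thesis using x
      by (simp add: bil_add_scaled lam_def algebra_simps power2_eq_square)
  qed
  then have "bil N H y x - lam * (\<Sum>i\<in>N. c i * y i * x i) = 0"
    by (rule linear_coeff_zero)
  \<comment> \<open>The linear coefficient is the inner product of \<open>y\<close> with
    \<open>A x - lam x\<close>, which is \<open>y\<close> itself.\<close>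
  moreover have "bil N H y x - lam * (\<Sum>i\<in>N. c i * y i * x i) = n y"
  proof -
    have "c i * (y i)\<^sup>2 = y i * (\<Sum>j\<in>N. H i j * x j) - lam * (c i * y i * x i)" if "i \<in> N" for i
    proof -
      have "c i * y i = (\<Sum>j\<in>N. H i j * x j) - lam * (c i * x i)"
        using hpos[OF that] w[OF that] by (simp add: y_def c_def field_simps)
      then have "y i * (c i * y i) = y i * ((\<Sum>j\<in>N. H i j * x j) - lam * (c i * x i))" by simp
      then show ?thesis by (simp add: algebra_simps power2_eq_square)
    qed
    then show ?thesis by (simp add: n_def bil_eq sum_subtractf sum_distrib_left)
  qed
  ultimately have y: "\<forall>i\<in>N. y i = 0" by (simp add: n_eq_0)
  have "w i * (\<Sum>j\<in>N. H i j * x j)\<^sup>2 / h i = lam\<^sup>2 * (c i * (x i)\<^sup>2)" if "i \<in> N" for i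
  proof -
    have "w i * (\<Sum>j\<in>N. H i j * x j) / h i = lam * x i"
      using y that by (simp add: y_def)
    then have s: "(\<Sum>j\<in>N. H i j * x j) = lam * (h i / w i * x i)"
      using hpos[OF that] w[OF that] by (simp add: field_simps)
    show ?thesis unfolding s using hpos[OF that] w[OF that]
      by (simp add: c_def field_simps power2_eq_square)
  qed
  then have "(\<Sum>i\<in>N. w i * (\<Sum>j\<in>N. H i j * x j)\<^sup>2 / h i) = lam\<^sup>2 * n x"
    by (simp add: n_def sum_distrib_left)
  \<comment> \<open>At the eigenvector \<open>x\<close> the two sides of \<open>hyp\<close> are
    \<open>lam\<close> and \<open>lam\<^sup>2\<close>.\<close>
  then have "lam \<le> lam\<^sup>2" using hyp[of x] x by (simp add: lam_def)
  then have "lam \<ge> 1" using \<open>lam > 0\<close> by (simp add: power2_eq_square)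
  define g where "g i = x i / w i" for i
  have xg: "x i = w i * g i" if "i \<in> N" for i using w[OF that] by (simp add: g_def)
  (* Dirichlet form of D - H: it forces lam <= 1, with equality only for x proportional to w *)
  have energy: "(\<Sum>i\<in>N. \<Sum>j\<in>N. w i * H i j * w j * (g i - g j)\<^sup>2) = 2 * (n x - lam)"
  proof -
    have a: "(\<Sum>i\<in>N. \<Sum>j\<in>N. w i * H i j * w j * (g i)\<^sup>2) = n x"
      unfolding n_def
    proof (intro sum.cong refl)
      fix i assume i: "i \<in> N"
      have "(\<Sum>j\<in>N. w i * H i j * w j * (g i)\<^sup>2) = w i * (g i)\<^sup>2 * h i"
        unfolding h[OF i] by (simp add: sum_distrib_left mult_ac)
      also have "\<dots> = c i * (x i)\<^sup>2"
        using w[OF i] by (simp add: c_def g_def power_divide power2_eq_square)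
      finally show "(\<Sum>j\<in>N. w i * H i j * w j * (g i)\<^sup>2) = c i * (x i)\<^sup>2" .
    qed
    have b: "(\<Sum>i\<in>N. \<Sum>j\<in>N. w i * H i j * w j * (g j)\<^sup>2) = n x"
      unfolding a[symmetric] by (subst sum.swap) (simp add: sym[of _ "_"] mult_ac)
    have "lam = (\<Sum>i\<in>N. \<Sum>j\<in>N. w i * H i j * w j * (g i * g j))"
      unfolding lam_def bil_def by (intro sum.cong refl) (simp add: xg mult_ac)
    then show ?thesis using a b
      by (simp add: power2_diff algebra_simps sum.distrib sum_subtractf sum_distrib_left)
  qed
  have term_nonneg: "w i * H i j * w j * (g i - g j)\<^sup>2 \<ge> 0" if "i \<in> N" "j \<in> N" for i j
    using w[OF that(1)] w[OF that(2)] nonneg[of i j] by simp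
  have g_eq: "g i = g j" if ij: "i \<in> N" "j \<in> N" "H i j > 0" for i j
  proof -
    have "(\<Sum>i\<in>N. \<Sum>j\<in>N. w i * H i j * w j * (g i - g j)\<^sup>2) = 0"
      using energy x \<open>lam \<ge> 1\<close> term_nonneg
      by (intro antisym sum_nonneg) auto
    then have "w i * H i j * w j * (g i - g j)\<^sup>2 = 0"
      using fin term_nonneg ij by (fastforce simp: sum_nonneg_eq_0_iff sum_nonneg)
    then show ?thesis using w[OF ij(1)] w[OF ij(2)] ij(3) by simp
  qed
  have const: "g i = g j" if "i \<in> N" "j \<in> N" for i j
    using conn[OF that] g_eq that by metis
  have "N \<noteq> {}" using x(1) by (auto simp: n_def)
  then obtain i0 where i0: "i0 \<in> N" by blast
  have "(\<Sum>i\<in>N. h i * x i) = (\<Sum>i\<in>N. h i * w i) * g i0"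
    unfolding sum_distrib_right using const[OF _ i0] xg by (intro sum.cong refl) (simp add: mult_ac)
  moreover have "(\<Sum>i\<in>N. h i * w i) > 0"
    using fin i0 w hpos by (intro sum_pos) auto
  ultimately have "g i0 = 0" using x by simp
  then have "\<forall>i\<in>N. x i = 0" using const[OF _ i0] xg by simp
  then show False using x n_eq_0[of x] by simp
qed

text \<open>The matrix of an equivalence relation is positive semidefinite: its form is the sum of
  the squares of the class sums.\<close>

lemma sum_same_class_nonneg:
  fixes v :: "'a \<Rightarrow> real"
  assumes "finite N"
  shows "(\<Sum>i\<in>N. \<Sum>j\<in>N. of_bool (f i = f j) * (v i * v j)) \<ge> 0"
proof -
  have "(\<Sum>i\<in>N. \<Sum>j\<in>N. of_bool (f i = f j) * (v i * v j))
      = (\<Sum>i\<in>N. \<Sum>j\<in>N. \<Sum>c\<in>f ` N. (of_bool (f i = c) * v i) * (of_bool (f j = c) * v j))"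
  proof (intro sum.cong refl)
    fix i j assume "i \<in> N" "j \<in> N"
    have "(\<Sum>c\<in>f ` N. (of_bool (f i = c) * v i) * (of_bool (f j = c) * v j))
        = (\<Sum>c\<in>f ` N. if c = f i then of_bool (f j = f i) * (v i * v j) else 0)"
      by (intro sum.cong) auto
    also have "\<dots> = of_bool (f i = f j) * (v i * v j)"
      using assms \<open>i \<in> N\<close> by (auto simp: sum.delta)
    finally show "of_bool (f i = f j) * (v i * v j)
      = (\<Sum>c\<in>f ` N. (of_bool (f i = c) * v i) * (of_bool (f j = c) * v j))" ..
  qed
  also have "\<dots> = (\<Sum>c\<in>f ` N. \<Sum>i\<in>N. \<Sum>j\<in>N. (of_bool (f i = c) * v i) * (of_bool (f j = c) * v j))"
    by (subst sum.swap, subst (2) sum.swap, subst sum.swap) (rule sum.cong[OF refl sum.swap])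
  also have "\<dots> = (\<Sum>c\<in>f ` N. (\<Sum>i\<in>N. of_bool (f i = c) * v i)\<^sup>2)"
    by (simp add: power2_eq_square sum_product)
  also have "\<dots> \<ge> 0" by (intro sum_nonneg) simp
  finally show ?thesis .
qed

section \<open>Alexandrov--Fenchel inequality for matroid bases\<close>

text \<open>
  The derivative, along the directions in the list, of the basis generating polynomial of the
  contraction by \<open>X\<close>, provided the length of the list is the corank of \<open>X\<close>. The sum may run over
  all of \<open>G\<close> because the terms with \<open>i \<in> X\<close> then vanish: the set can no longer reach the
  cardinality of a basis.
\<close>
fun mixed :: "'a set \<Rightarrow> 'a set set \<Rightarrow> 'a set \<Rightarrow> ('a \<Rightarrow> real) list \<Rightarrow> real" where
  "mixed G B X [] = of_bool (X \<in> B)"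
| "mixed G B X (u # us) = (\<Sum>i\<in>G. u i * mixed G B (insert i X) us)"

lemma mixed_nonneg:
  assumes "\<And>u i. u \<in> set us \<Longrightarrow> i \<in> G \<Longrightarrow> u i \<ge> 0"
  shows "mixed G B X us \<ge> 0"
  using assms by (induction us arbitrary: X) (auto intro!: sum_nonneg mult_nonneg_nonneg)

lemma continuous_mixed:
  assumes "\<And>c i. continuous_on UNIV (\<lambda>t. u t c i)"
  shows "continuous_on UNIV (\<lambda>t. mixed G B X (map (u t) cs))"
  using assms by (induction cs arbitrary: X) (auto intro!: continuous_intros)

locale matroid_bases =
  fixes G :: "'a set" and B :: "'a set set" and d :: nat
  assumes finite_ground: "finite G"
    and nonempty: "B \<noteq> {}"
    and subset_ground: "Y \<in> B \<Longrightarrow> Y \<subseteq> G"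
    and card_basis: "Y \<in> B \<Longrightarrow> card Y = d"
    and basis_exchange: "Y \<in> B \<Longrightarrow> Z \<in> B \<Longrightarrow> x \<in> Y - Z \<Longrightarrow> \<exists>y\<in>Z - Y. insert y (Y - {x}) \<in> B"
begin

section \<open>Independent sets, basis exchange and duality\<close>

definition indep :: "'a set \<Rightarrow> bool" where
  "indep X \<longleftrightarrow> (\<exists>Y\<in>B. X \<subseteq> Y)"

lemma finite_basis: "Y \<in> B \<Longrightarrow> finite Y"
  using subset_ground finite_ground finite_subset by blast

lemma finite_bases: "finite B"
  using subset_ground finite_ground by (meson PowI finite_Pow_iff finite_subset subsetI)

lemma indep_finite: "indep X \<Longrightarrow> finite X"
  unfolding indep_def using finite_basis finite_subset by blast

lemma indep_subset: "indep X \<Longrightarrow> Z \<subseteq> X \<Longrightarrow> indep Z"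
  unfolding indep_def by blast

lemma indep_full_card: "indep X \<Longrightarrow> card X = d \<Longrightarrow> X \<in> B"
  unfolding indep_def using card_basis finite_basis card_subset_eq by metis

text \<open>Elements of \<open>Y\<close> outside \<open>insert j Z\<close> are exchanged one by one
  for elements of \<open>Z\<close>. This never touches \<open>insert j X\<close>, since
  \<open>X \<subseteq> Z\<close>, and it lowers \<open>card (Y - Z)\<close>.\<close>

lemma basis_near:
  assumes "Y \<in> B" "insert j X \<subseteq> Y" "Z \<in> B" "X \<subseteq> Z"
  obtains C where "C \<in> B" "insert j X \<subseteq> C" "C \<subseteq> insert j Z"
proof -
  have "\<exists>C\<in>B. insert j X \<subseteq> C \<and> C \<subseteq> insert j Z"
    using assms(1,2)
  proof (induction "card (Y - Z)" arbitrary: Y rule: less_induct)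
    case less
    show ?case
    proof (cases "Y \<subseteq> insert j Z")
      case True
      with less.prems show ?thesis by blast
    next
      case False
      then obtain x where x: "x \<in> Y - Z" "x \<noteq> j" by blast
      then obtain y where y: "y \<in> Z - Y" "insert y (Y - {x}) \<in> B"
        using basis_exchange[OF less.prems(1) assms(3) x(1)] by blast
      have "insert y (Y - {x}) - Z = (Y - Z) - {x}" using y by blast
      then have "card (insert y (Y - {x}) - Z) < card (Y - Z)"
        using x finite_basis[OF less.prems(1)] by (metis card_Diff1_less finite_Diff)
      moreover have "insert j X \<subseteq> insert y (Y - {x})"
        using x less.prems assms by blast
      ultimately show ?thesis using less.hyps y(2) by meson
    qed
  qed
  with that show thesis by blast
qed

text \<open>A basis inside \<open>insert j Z\<close>, with \<open>Z\<close> a basis containing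
  \<open>i\<close> and \<open>k\<close>, misses at most one element of \<open>Z\<close>. Read
  contrapositively, being parallel in the contraction by \<open>X\<close> is transitive.\<close>

lemma indep_pair_exchange:
  assumes ik: "indep (insert i (insert k X))" and j: "indep (insert j X)"
    and "i \<noteq> k" "i \<notin> X" "k \<notin> X"
  shows "indep (insert i (insert j X)) \<or> indep (insert j (insert k X))"
proof -
  obtain Y Z where Y: "Y \<in> B" "insert j X \<subseteq> Y" and Z: "Z \<in> B" "insert i (insert k X) \<subseteq> Z"
    using ik j unfolding indep_def by blast
  moreover from this have "X \<subseteq> Z" by blast
  ultimately obtain C where C: "C \<in> B" "insert j X \<subseteq> C" "C \<subseteq> insert j Z"
    using basis_near[of Y j X Z] by metis
  have "i \<in> C \<or> k \<in> C"
  proof (rule ccontr)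
    assume "\<not> (i \<in> C \<or> k \<in> C)"
    then have "C \<subseteq> insert j (Z - {i, k})" using C by blast
    then have "card C \<le> card (insert j (Z - {i, k}))"
      using finite_basis[OF Z(1)] by (intro card_mono) auto
    also have "\<dots> \<le> Suc (card (Z - {i, k}))"
      using finite_basis[OF Z(1)] by (simp add: card_insert_if)
    finally have "card C \<le> Suc (card (Z - {i, k}))" .
    moreover have "card (Z - {i, k}) = d - 2" "d \<ge> 2"
      using Z \<open>i \<noteq> k\<close> card_basis[OF Z(1)] finite_basis[OF Z(1)] card_mono[of Z "{i,k}"]
      by (simp_all add: card_Diff_subset)
    ultimately show False using card_basis[OF C(1)] by simp
  qed
  then show ?thesis using C unfolding indep_def by blast
qed

lemma dual_bases: "matroid_bases G ((\<lambda>Y. G - Y) ` B) (card G - d)"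
proof
  show "finite G" by (rule finite_ground)
  show "(\<lambda>Y. G - Y) ` B \<noteq> {}" using nonempty by blast
  fix Y assume Y: "Y \<in> (\<lambda>Y. G - Y) ` B"
  then show "Y \<subseteq> G" by blast
  show "card Y = card G - d"
    using Y subset_ground card_basis finite_basis by (auto simp: card_Diff_subset)
  fix Z x assume Z: "Z \<in> (\<lambda>Y. G - Y) ` B" and x: "x \<in> Y - Z"
  obtain Y' Z' where Y': "Y' \<in> B" "Y = G - Y'" and Z': "Z' \<in> B" "Z = G - Z'"
    using Y Z by blast
  \<comment> \<open>Here \<open>x\<close> lies in \<open>Z' - Y'\<close>. A basis within
    \<open>insert x Y'\<close> that contains \<open>x\<close> drops exactly one element of
    \<open>Y'\<close>; keeping \<open>Y' \<inter> Z'\<close> forces that element out of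
    \<open>Z'\<close>, hence into \<open>Z\<close>.\<close>
  have "insert x (Y' \<inter> Z') \<subseteq> Z'" using x Y' Z' by blast
  then obtain C where C: "C \<in> B" "insert x (Y' \<inter> Z') \<subseteq> C" "C \<subseteq> insert x Y'"
    using basis_near[of Z' x "Y' \<inter> Z'" Y'] Y' Z' by (metis Int_lower1)
  have "\<not> Y' \<subseteq> C"
  proof
    assume "Y' \<subseteq> C"
    then have "Y' = C" using card_basis Y' C finite_basis by (metis card_subset_eq)
    then show False using C x Y' by blast
  qed
  then obtain y where y: "y \<in> Y'" "y \<notin> C" by blast
  have "C \<subseteq> insert x (Y' - {y})" using C y by blast
  moreover have "card (insert x (Y' - {y})) = Suc (card (Y' - {y}))"
    using x Y' finite_basis[OF Y'(1)] by simp
  then have "card C = card (insert x (Y' - {y}))"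
    using card_Suc_Diff1[OF finite_basis[OF Y'(1)] y(1)] card_basis[OF Y'(1)] card_basis[OF C(1)] by simp
  ultimately have "C = insert x (Y' - {y})"
    using finite_basis[OF Y'(1)] by (intro card_subset_eq) auto
  then have "G - C = insert y (Y - {x})"
    using y subset_ground[OF Y'(1)] x Y' by blast
  moreover have "y \<in> Z - Y"
    using y C subset_ground[OF Y'(1)] Y' Z' by blast
  ultimately show "\<exists>y\<in>Z - Y. insert y (Y - {x}) \<in> (\<lambda>Y. G - Y) ` B"
    using C(1) by (metis imageI)
qed

section \<open>Vanishing and positivity of mixed derivatives\<close>

lemma mixed_eq_0:
  assumes "finite X" "\<not> indep X \<or> card X + length us < d"
  shows "mixed G B X us = 0"
  using assms
proof (induction us arbitrary: X)
  case Nil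
  then show ?case using card_basis by (auto simp: indep_def)
next
  case (Cons u us)
  have "mixed G B (insert i X) us = 0" for i
  proof (rule Cons.IH)
    show "\<not> indep (insert i X) \<or> card (insert i X) + length us < d"
      using Cons.prems card_insert_le_m1[of "Suc (card X)" X i] indep_subset[of "insert i X" X]
      by (auto simp: card_insert_if)
  qed (use Cons.prems in simp)
  then show ?case by simp
qed

lemma mixed_pos:
  assumes "indep X" "card X + length us = d" "\<And>u i. u \<in> set us \<Longrightarrow> i \<in> G \<Longrightarrow> u i > 0"
  shows "mixed G B X us > 0"
  using assms
proof (induction us arbitrary: X)
  case Nil
  then show ?case using indep_full_card by simp
next
  case (Cons u us)
  obtain Y where Y: "Y \<in> B" "X \<subseteq> Y" using Cons.prems by (auto simp: indep_def)
  have "X \<noteq> Y" using card_basis[OF Y(1)] Cons.prems by auto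
  then obtain i where i: "i \<in> Y" "i \<notin> X" using Y by blast
  have "i \<in> G" using i Y subset_ground by blast
  have fX: "finite X" using Cons.prems indep_finite by blast
  have "mixed G B (insert i X) us > 0"
    using Cons.prems i Y fX by (intro Cons.IH) (auto simp: indep_def)
  then have "u i * mixed G B (insert i X) us > 0"
    using \<open>i \<in> G\<close> Cons.prems(3) by (intro mult_pos_pos) auto
  moreover have "u j * mixed G B (insert j X) us \<ge> 0" if "j \<in> G" for j
    using Cons.prems(3) that by (intro mult_nonneg_nonneg mixed_nonneg less_imp_le) auto
  ultimately show ?case using finite_ground \<open>i \<in> G\<close> by (auto intro!: sum_pos2)
qed

text \<open>The Hessian left after differentiating along \<open>us\<close>; evaluating its form at
  two vectors amounts to putting them in front of the list.\<close>

abbreviation hess :: "'a set \<Rightarrow> ('a \<Rightarrow> real) list \<Rightarrow> 'a \<Rightarrow> 'a \<Rightarrow> real" where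
  "hess X us i j \<equiv> mixed G B (insert i (insert j X)) us"

lemma bil_hess: "bil G (hess X us) u v = mixed G B X (u # v # us)"
  unfolding bil_def by (simp add: sum_distrib_left mult_ac insert_commute)

lemma hess_eq_0:
  assumes "finite X" "card X + length us + 2 = d"
    and "i \<in> X \<or> \<not> indep (insert i X) \<or> j \<in> X \<or> \<not> indep (insert j X)"
  shows "hess X us i j = 0"
proof (rule mixed_eq_0)
  show "\<not> indep (insert i (insert j X)) \<or> card (insert i (insert j X)) + length us < d"
  proof (cases "i \<in> X \<or> j \<in> X")
    case True
    then show ?thesis using assms(1,2) by (auto simp: card_insert_if)
  next
    case False
    then have "\<not> indep (insert i X) \<or> \<not> indep (insert j X)" using assms(3) by blast
    moreover have "insert i X \<subseteq> insert i (insert j X)" "insert j X \<subseteq> insert i (insert j X)"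
      by blast+
    ultimately show ?thesis using indep_subset by metis
  qed
qed (use assms(1) in simp)

lemma hess_pos_iff:
  assumes "finite X" "card X + length us + 2 = d" "\<And>u i. u \<in> set us \<Longrightarrow> i \<in> G \<Longrightarrow> u i > 0"
  shows "hess X us i j > 0 \<longleftrightarrow> i \<noteq> j \<and> i \<notin> X \<and> j \<notin> X \<and> indep (insert i (insert j X))"
proof -
  have "hess X us i j = 0" if "i = j \<or> i \<in> X \<or> j \<in> X \<or> \<not> indep (insert i (insert j X))"
    using assms that by (intro mixed_eq_0) (auto simp: card_insert_if)
  moreover have "hess X us i j > 0" if "i \<noteq> j" "i \<notin> X" "j \<notin> X" "indep (insert i (insert j X))"
    using assms that by (intro mixed_pos) auto
  ultimately show ?thesis by (metis less_irrefl)
qed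

section \<open>The Hessian is nonpositive on a hyperplane\<close>

text \<open>On the nonloops of a rank-two contraction the Hessian is the adjacency matrix of the
  complete multipartite graph on the parallel classes: the all-ones matrix minus that of an
  equivalence relation. Where the coordinates on the nonloops sum to 0, only the negative part
  survives.\<close>

lemma rank_two_hyperplane:
  assumes "finite X" "card X + 2 = d"
  shows "\<exists>l. \<forall>v. (\<Sum>i\<in>G. l i * v i) = 0 \<longrightarrow> bil G (hess X []) v v \<le> 0"
proof -
  define N where "N = {i \<in> G - X. indep (insert i X)}"
  have fN: "finite N" "N \<subseteq> G" using finite_ground by (auto simp: N_def)
  \<comment> \<open>For a nonloop \<open>i\<close> this is its parallel class; it contains
    \<open>i\<close> because \<open>insert i X\<close> is too small to be a basis.\<close>
  define f where "f i = {j \<in> N. hess X [] i j = 0}" for i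
  have refl: "hess X [] i i = 0" for i
    using assms card_basis[of "insert i X"] by (auto simp: card_insert_if split: if_splits)
  have trans: "hess X [] j k = 0" if "hess X [] i j = 0" "hess X [] i k = 0" "i \<in> N" "j \<in> N" "k \<in> N" for i j k
  proof (rule ccontr)
    assume "hess X [] j k \<noteq> 0"
    then have "insert j (insert k X) \<in> B" by simp
    moreover from this have "j \<noteq> k" using refl[of j] by auto
    ultimately have "indep (insert j (insert i X)) \<or> indep (insert i (insert k X))"
      using that by (intro indep_pair_exchange) (auto simp: N_def indep_def)
    moreover have "i \<noteq> j" "i \<noteq> k" 
      using that \<open>hess X [] j k \<noteq> 0\<close> by (auto simp: insert_commute)
    ultimately have "insert j (insert i X) \<in> B \<or> insert i (insert k X) \<in> B"
      using that assms indep_full_card[of "insert j (insert i X)"] indep_full_card[of "insert i (insert k X)"]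
      by (auto simp: N_def)
    then show False using that by (auto simp: insert_commute)
  qed
  have comm: "hess X [] i j = hess X [] j i" for i j by (simp add: insert_commute)
  have f: "hess X [] i j = 1 - of_bool (f i = f j)" if "i \<in> N" "j \<in> N" for i j
  proof (cases "hess X [] i j = 0")
    case True
    have "f i = f j" using trans True that comm unfolding f_def by (metis (lifting))
    then show ?thesis using True by simp
  next
    case False
    have "j \<in> f j" using refl that(2) by (simp add: f_def del: mixed.simps)
    moreover have "j \<notin> f i" using False by (simp add: f_def del: mixed.simps)
    ultimately have "f i \<noteq> f j" by blast
    moreover have "hess X [] i j = 1" using False by simp
    ultimately show ?thesis by simp
  qed
  have "bil G (hess X []) v v \<le> 0" if v: "(\<Sum>i\<in>G. of_bool (i \<in> N) * v i) = 0" for v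
  proof -
    have "(\<Sum>i\<in>N. v i) = (\<Sum>i\<in>G. of_bool (i \<in> N) * v i)"
      by (rule sum.mono_neutral_cong_left[OF finite_ground fN(2)]) auto
    then have N0: "(\<Sum>i\<in>N. v i) = 0" using v by simp
    have z: "hess X [] i j = 0" if "i \<in> G" "j \<in> G" "i \<notin> N \<or> j \<notin> N" for i j
      using that assms by (intro hess_eq_0) (auto simp: N_def)
    have "bil G (hess X []) v v = bil N (hess X []) v v"
      using z by (intro bil_mono_neutral finite_ground fN)
    also have "\<dots> = (\<Sum>i\<in>N. \<Sum>j\<in>N. v i * v j) - (\<Sum>i\<in>N. \<Sum>j\<in>N. of_bool (f i = f j) * (v i * v j))"
      unfolding bil_def sum_subtractf[symmetric] by (intro sum.cong HOL.refl) (simp add: f algebra_simps del: mixed.simps)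
    also have "(\<Sum>i\<in>N. \<Sum>j\<in>N. v i * v j) = 0"
      using N0 by (simp flip: sum_product)
    finally show ?thesis using sum_same_class_nonneg[OF fN(1), of f v] by simp
  qed
  then show ?thesis by (intro exI[of _ "\<lambda>i. of_bool (i \<in> N)"]) blast
qed

text \<open>The induction hypothesis is applied to the contractions by one further nonloop
  \<open>k\<close>; reverse Cauchy--Schwarz against \<open>w\<close> turns it into the assumption
  \<open>hyp\<close> of \<open>bil_nonpos_on_hyperplane\<close>.\<close>

lemma hess_hyperplane:
  assumes "finite X" "card X + length us + 2 = d" "\<And>u i. u \<in> set us \<Longrightarrow> i \<in> G \<Longrightarrow> u i > 0"
  shows "\<exists>l. \<forall>v. (\<Sum>i\<in>G. l i * v i) = 0 \<longrightarrow> bil G (hess X us) v v \<le> 0"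
  using assms
proof (induction us arbitrary: X)
  case Nil
  then show ?case by (intro rank_two_hyperplane) auto
next
  case (Cons w us)
  define N where "N = {i \<in> G - X. indep (insert i X)}"
  have fN: "finite N" "N \<subseteq> G" using finite_ground by (auto simp: N_def)
  define H where "H = hess X (w # us)"
  \<comment> \<open>The doubled \<open>w\<close> has two readings: \<open>h\<close> is
    \<open>H\<close> applied to \<open>w\<close>, and \<open>h k\<close> is the value at
    \<open>w\<close> of the form of the contraction by \<open>k\<close>.\<close>
  define h where "h i = mixed G B (insert i X) (w # w # us)" for i
  have wpos: "w i > 0" if "i \<in> G" for i using Cons.prems(3) that by simp
  have H_sym: "H i j = H j i" for i j by (simp add: H_def insert_commute)
  have H_nonneg: "H i j \<ge> 0" for i j
    unfolding H_def using Cons.prems(3) by (intro mixed_nonneg less_imp_le)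
  have H_pos: "H i j > 0 \<longleftrightarrow> i \<noteq> j \<and> i \<notin> X \<and> j \<notin> X \<and> indep (insert i (insert j X))" for i j
    unfolding H_def using Cons.prems by (intro hess_pos_iff) auto
  have H_zero: "H i j = 0" if "i \<in> G" "j \<in> G" "i \<notin> N \<or> j \<notin> N" for i j
    unfolding H_def using that Cons.prems by (intro hess_eq_0) (auto simp: N_def)
  have h: "h i = (\<Sum>j\<in>N. H i j * w j)" if "i \<in> N" for i
  proof -
    have "h i = (\<Sum>j\<in>G. w j * H j i)" by (simp add: h_def H_def)
    also have "\<dots> = (\<Sum>j\<in>N. H i j * w j)"
      using that fN H_zero by (intro sum.mono_neutral_cong_right[OF finite_ground fN(2)]) (auto simp: H_sym)
    finally show ?thesis .
  qed
  have h_pos: "h i > 0" if "i \<in> N" for i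
    unfolding h_def using that Cons.prems by (intro mixed_pos) (auto simp: N_def)
  have conn: "H i j > 0 \<or> (\<exists>k\<in>N. H i k > 0 \<and> H j k > 0)" if ij: "i \<in> N" "j \<in> N" "i \<noteq> j" for i j
  proof (cases "indep (insert i (insert j X))")
    case True
    then show ?thesis using ij H_pos by (auto simp: N_def)
  next
    case False
    \<comment> \<open>Now \<open>i\<close> and \<open>j\<close> are parallel over \<open>X\<close>.
      As \<open>X\<close> has corank above 1, some \<open>k\<close> is not parallel to
      \<open>i\<close>, and by transitivity not to \<open>j\<close> either.\<close>
    obtain Y where Y: "Y \<in> B" "insert i X \<subseteq> Y" using ij by (auto simp: N_def indep_def)
    have "card (insert i X) < card Y"
      using card_basis[OF Y(1)] Cons.prems by (auto simp: card_insert_if)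
    then obtain k where k: "k \<in> Y" "k \<notin> insert i X" using Y by (metis less_irrefl subsetI subset_antisym)
    have ik: "indep (insert i (insert k X))" using Y k by (auto simp: indep_def)
    then have jk: "indep (insert j (insert k X))"
      using indep_pair_exchange[of i k X j] k ij False by (auto simp: N_def)
    have "k \<in> N" using ik k subset_ground[OF Y(1)] indep_subset[OF ik, of "insert k X"] by (auto simp: N_def)
    moreover have "j \<noteq> k" using ik False by auto
    ultimately have "k \<in> N \<and> H i k > 0 \<and> H j k > 0" using ik jk k ij H_pos by (auto simp: N_def)
    then show ?thesis by blast
  qed
  have bil_GN: "bil G H v v = bil N H v v" for v
    using H_zero by (intro bil_mono_neutral finite_ground fN)
  have hyp: "bil N H v v \<le> (\<Sum>k\<in>N. w k * (\<Sum>j\<in>N. H k j * v j)\<^sup>2 / h k)" for v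
  proof -
    have "bil G H v v = (\<Sum>k\<in>G. w k * bil G (hess (insert k X) us) v v)"
      unfolding bil_def H_def mixed.simps sum_distrib_left sum_distrib_right
      by (subst sum.swap, subst (2) sum.swap, subst sum.swap) (simp add: insert_commute mult_ac)
    also have "\<dots> = (\<Sum>k\<in>N. w k * bil G (hess (insert k X) us) v v)"
    proof (rule sum.mono_neutral_right[OF finite_ground fN(2)], rule ballI)
      fix k assume k: "k \<in> G - N"
      have "hess (insert k X) us i j = 0" for i j
        using k Cons.prems by (intro mixed_eq_0)
         (auto simp: N_def card_insert_if dest: indep_subset[of _ "insert k X"])
      then show "w k * bil G (hess (insert k X) us) v v = 0" by (simp add: bil_def)
    qed
    also have "\<dots> \<le> (\<Sum>k\<in>N. w k * ((\<Sum>j\<in>N. H k j * v j)\<^sup>2 / h k))"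
    proof (intro sum_mono mult_left_mono)
      fix k assume k: "k \<in> N"
      let ?Hk = "hess (insert k X) us"
      have sym: "?Hk i j = ?Hk j i" for i j by (simp add: insert_commute)
      obtain l where l: "\<And>v. (\<Sum>i\<in>G. l i * v i) = 0 \<Longrightarrow> bil G ?Hk v v \<le> 0"
        using Cons.IH[of "insert k X"] Cons.prems k by (auto simp: N_def)
      have ww: "bil G ?Hk w w = h k" by (simp only: bil_hess h_def)
      \<comment> \<open>Pairing with \<open>w\<close> returns it to the direction list, which leaves
        row \<open>k\<close> of \<open>H\<close>.\<close>
      have "bil G ?Hk v w = (\<Sum>j\<in>G. H k j * v j)"
        unfolding bil_hess H_def by (simp add: insert_commute mult.commute)
      also have "\<dots> = (\<Sum>j\<in>N. H k j * v j)"
        using H_zero k fN by (intro sum.mono_neutral_right[OF finite_ground fN(2)]) auto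
      finally have vw: "bil G ?Hk v w = (\<Sum>j\<in>N. H k j * v j)" .
      have "bil G ?Hk v v * h k \<le> (\<Sum>j\<in>N. H k j * v j)\<^sup>2"
        using reverse_cauchy_schwarz[where H = ?Hk and N = G and l = l and w = w and v = v] sym l h_pos[OF k] unfolding ww vw by blast
      then show "bil G ?Hk v v \<le> (\<Sum>j\<in>N. H k j * v j)\<^sup>2 / h k"
        using h_pos[OF k] by (simp add: pos_le_divide_eq)
    qed (use wpos fN in \<open>auto intro: less_imp_le\<close>)
    finally show ?thesis by (simp add: bil_GN)
  qed
  have "bil G H v v \<le> 0" if v: "(\<Sum>i\<in>G. (if i \<in> N then h i else 0) * v i) = 0" for v
  proof -
    have "(\<Sum>i\<in>N. h i * v i) = (\<Sum>i\<in>G. (if i \<in> N then h i else 0) * v i)"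
      by (rule sum.mono_neutral_cong_left[OF finite_ground fN(2)]) auto
    then have "(\<Sum>i\<in>N. h i * v i) = 0" using v by simp
    then show ?thesis unfolding bil_GN
      using bil_nonpos_on_hyperplane[of N H w h v] fN H_sym H_nonneg wpos h h_pos conn hyp by blast
  qed
  then show ?case unfolding H_def by (intro exI[of _ "\<lambda>i. if i \<in> N then h i else 0"]) blast
qed

lemma mixed_alexandrov_fenchel:
  assumes "length us + 2 = d" "\<And>u i. u \<in> set (v # w # us) \<Longrightarrow> i \<in> G \<Longrightarrow> u i > 0"
  shows "mixed G B {} (v # v # us) * mixed G B {} (w # w # us) \<le> (mixed G B {} (v # w # us))\<^sup>2"
proof -
  obtain l where l: "\<And>v. (\<Sum>i\<in>G. l i * v i) = 0 \<Longrightarrow> bil G (hess {} us) v v \<le> 0"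
    using hess_hyperplane[of "{}" us] assms by auto
  have "indep {}" using nonempty by (auto simp: indep_def)
  then have "mixed G B {} (w # w # us) > 0" using assms by (intro mixed_pos) auto
  then show ?thesis
    using reverse_cauchy_schwarz[where H = "hess {} us" and N = G and l = l and w = w and v = v] l unfolding bil_hess by (metis insert_commute)
qed


section \<open>From indicator directions to basis counts\<close>

text \<open>The expansion enumerates ordered ways of adding elements to \<open>X\<close>, a position
  of colour \<open>c\<close> taking an element of \<open>P c\<close>. A basis with the right colour
  counts arises once per assignment of its new elements to positions of their colour, hence the
  factorials.\<close>

lemma mixed_indicator:
  assumes "finite X" "card X + length cs = d"
    and disj: "P True \<inter> P False = {}" and cover: "P True \<union> P False = G"
  shows "mixed G B X (map (\<lambda>c i. of_bool (i \<in> P c)) cs)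
    = fact (count_list cs True) * fact (count_list cs False)
      * card {Y \<in> B. X \<subseteq> Y \<and> (\<forall>c. card ((Y - X) \<inter> P c) = count_list cs c)}"
  using assms(1,2)
proof (induction cs arbitrary: X)
  case Nil
  have "{Y \<in> B. X \<subseteq> Y \<and> (\<forall>c. card ((Y - X) \<inter> P c) = 0)} = {Y \<in> B. Y = X}"
  proof -
    have "Y = X" if "Y \<in> B" "X \<subseteq> Y" for Y
      using that Nil card_basis finite_basis card_subset_eq by (metis add.right_neutral list.size(3))
    then show ?thesis by auto
  qed
  moreover have "card {Y \<in> B. Y = X} = of_bool (X \<in> B)"
    by (cases "X \<in> B") (auto simp: conj_commute cong: conj_cong)
  ultimately show ?case by simp
next
  case (Cons c cs)
  let ?K = "fact (count_list cs True) * fact (count_list cs False) :: real"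
  define S where "S = {Y \<in> B. X \<subseteq> Y \<and> (\<forall>c'. card ((Y - X) \<inter> P c') = count_list (c # cs) c')}"
  have fS: "finite S" using finite_bases by (simp add: S_def)
  have PG: "P c \<subseteq> G" using cover by (cases c) auto
  have fin_Pc: "finite (P c)" using PG finite_ground finite_subset by blast
  have step: "mixed G B (insert i X) (map (\<lambda>c i. of_bool (i \<in> P c)) cs)
      = ?K * (\<Sum>Y\<in>S. of_bool (i \<in> Y - X))" if i: "i \<in> P c" for i
  proof (cases "i \<in> X")
    case True
    have "mixed G B (insert i X) (map (\<lambda>c i. of_bool (i \<in> P c)) cs) = 0"
      using True Cons.prems by (intro mixed_eq_0) (auto simp: insert_absorb)
    then show ?thesis using True by simp
  next
    case False
    have "{Y \<in> B. insert i X \<subseteq> Y \<and> (\<forall>c'. card ((Y - insert i X) \<inter> P c') = count_list cs c')}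
        = {Y \<in> S. i \<in> Y - X}"
    proof -
      have "(card ((Y - insert i X) \<inter> P c') = count_list cs c')
         \<longleftrightarrow> (card ((Y - X) \<inter> P c') = count_list (c # cs) c')" if Y: "Y \<in> B" "i \<in> Y" for Y c'
      proof (cases "c' = c")
        case True
        have "(Y - X) \<inter> P c = insert i ((Y - insert i X) \<inter> P c)" using Y i False by blast
        then have "card ((Y - X) \<inter> P c) = Suc (card ((Y - insert i X) \<inter> P c))"
          using finite_basis[OF Y(1)] by simp
        then show ?thesis using True by simp
      next
        case c: False
        have "i \<notin> P c'" using c i disj by (cases c; cases c') auto
        then have "(Y - insert i X) \<inter> P c' = (Y - X) \<inter> P c'" by blast
        then show ?thesis using c by simp
      qed
      then show ?thesis using False unfolding S_def by (auto simp del: count_list.simps)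
    qed
    moreover have "(\<Sum>Y\<in>S. of_bool (i \<in> Y - X)) = real (card {Y \<in> S. i \<in> Y - X})"
      using fS by (simp add: Int_def)
    ultimately show ?thesis
      using Cons.IH[of "insert i X"] Cons.prems False by simp
  qed
  have "mixed G B X (map (\<lambda>c i. of_bool (i \<in> P c)) (c # cs))
      = (\<Sum>i\<in>P c. mixed G B (insert i X) (map (\<lambda>c i. of_bool (i \<in> P c)) cs))"
    by (simp, rule sum.mono_neutral_cong_right[OF finite_ground PG]) auto
  also have "\<dots> = (\<Sum>i\<in>P c. ?K * (\<Sum>Y\<in>S. of_bool (i \<in> Y - X)))"
    using step by simp
  also have "\<dots> = ?K * (\<Sum>Y\<in>S. \<Sum>i\<in>P c. of_bool (i \<in> Y - X))"
    by (simp add: sum_distrib_left[symmetric]) (rule sum.swap)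
  \<comment> \<open>The inner sum counts the choices of the first element within \<open>Y\<close>;
    this factor raises the factorial of colour \<open>c\<close> by one.\<close>
  also have "(\<Sum>Y\<in>S. \<Sum>i\<in>P c. of_bool (i \<in> Y - X)) = (\<Sum>Y\<in>S. real (Suc (count_list cs c)))"
  proof (intro sum.cong refl)
    fix Y assume "Y \<in> S"
    then have "card ((Y - X) \<inter> P c) = Suc (count_list cs c)" by (simp add: S_def)
    moreover have "(\<Sum>i\<in>P c. of_bool (i \<in> Y - X)) = real (card ((Y - X) \<inter> P c))"
      using fin_Pc by (simp add: Int_def conj_commute)
    ultimately show "(\<Sum>i\<in>P c. of_bool (i \<in> Y - X)) = real (Suc (count_list cs c))" by simp
  qed
  also have "?K * \<dots> = fact (count_list (c # cs) True) * fact (count_list (c # cs) False) * card S"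
    by (cases c) (simp_all add: algebra_simps)
  finally show ?case unfolding S_def .
qed

text \<open>Indicators have zeros, so these are replaced by \<open>t > 0\<close> to reach the
  positive case, and \<open>t\<close> tends to 0 from the right.\<close>

lemma indicator_alexandrov_fenchel:
  assumes "length cs + 2 = d" and disj: "P True \<inter> P False = {}" and cover: "P True \<union> P False = G"
  defines "V \<equiv> \<lambda>cs. mixed G B {} (map (\<lambda>c i. of_bool (i \<in> P c)) cs)"
  shows "V (True # True # cs) * V (False # False # cs) \<le> (V (True # False # cs))\<^sup>2"
proof -
  define u where "u t c i = (if i \<in> P c then 1 else t)" for t :: real and c i
  define W where "W t cs = mixed G B {} (map (u t) cs)" for t cs
  have "continuous_on UNIV (\<lambda>t. u t c i)" for c i
    by (cases "i \<in> P c") (simp_all add: u_def)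
  then have "continuous_on UNIV (\<lambda>t. W t cs)" for cs
    unfolding W_def by (rule continuous_mixed)
  then have "isCont (\<lambda>t. W t cs) 0" for cs
    by (simp add: continuous_on_eq_continuous_at)
  then have lim: "((\<lambda>t. W t cs) \<longlongrightarrow> W 0 cs) (at_right 0)" for cs
    unfolding isCont_def using filterlim_at_split by blast
  have "W t (True # True # cs) * W t (False # False # cs) \<le> (W t (True # False # cs))\<^sup>2" if "t > 0" for t
    unfolding W_def list.map using assms(1) that by (intro mixed_alexandrov_fenchel) (auto simp: u_def)
  then have "eventually (\<lambda>t. W t (True # True # cs) * W t (False # False # cs)
      \<le> (W t (True # False # cs))\<^sup>2) (at_right 0)"
    by (intro eventually_at_right_less[THEN eventually_mono]) auto
  moreover have "((\<lambda>t. W t (True # True # cs) * W t (False # False # cs)) \<longlongrightarrow> W 0 (True # True # cs) * W 0 (False # False # cs)) (at_right 0)"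
    and "((\<lambda>t. (W t (True # False # cs))\<^sup>2) \<longlongrightarrow> (W 0 (True # False # cs))\<^sup>2) (at_right 0)"
    by (intro tendsto_intros lim)+
  ultimately have "W 0 (True # True # cs) * W 0 (False # False # cs) \<le> (W 0 (True # False # cs))\<^sup>2"
    using tendsto_le trivial_limit_at_right_real by blast
  moreover have "W 0 = V"
    by (auto simp: W_def V_def u_def fun_eq_iff of_bool_def intro!: arg_cong[where f = "mixed G B {}"])
  ultimately show ?thesis by simp
qed

text \<open>Differentiating along \<open>d\<close> indicators, \<open>k\<close> of them that of
  \<open>Q\<close>, gives \<open>fact d * (N k / (d choose k))\<close>; the claim compares three
  such words.\<close>

lemma bases_ultra_log_concave:
  assumes "Q \<subseteq> G" "k \<ge> 1"
  defines "N \<equiv> \<lambda>k. real (card {Y \<in> B. card (Y \<inter> Q) = k})"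
  shows "N (k + 1) / (d choose (k + 1)) * (N (k - 1) / (d choose (k - 1))) \<le> (N k)\<^sup>2 / (d choose k)\<^sup>2"
proof (cases "k < d")
  \<comment> \<open>Here \<open>d choose (k + 1)\<close> is 0, and division by zero makes the left
    side 0.\<close>
  case False
  then show ?thesis by (simp add: binomial_eq_0)
next
  case True
  define P where "P c = (if c then G - Q else Q)" for c
  have disj: "P True \<inter> P False = {}" and cover: "P True \<union> P False = G"
    using assms(1) by (auto simp: P_def)
  have eval: "mixed G B {} (map (\<lambda>c i. of_bool (i \<in> P c)) cs)
      = fact d * (N (count_list cs False) / (d choose count_list cs False))" if "length cs = d" for cs
  proof -
    have tot: "count_list cs True + count_list cs False = d"
      unfolding that[symmetric] by (induction cs) auto
    have "card (Y \<inter> P True) = count_list cs True \<and> card (Y \<inter> P False) = count_list cs False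
       \<longleftrightarrow> card (Y \<inter> Q) = count_list cs False" if "Y \<in> B" for Y
    proof -
      have "Y = (Y \<inter> P True) \<union> (Y \<inter> P False)" using cover subset_ground[OF that] by blast
      then have "d = card (Y \<inter> P True) + card (Y \<inter> P False)"
        using card_basis[OF that] finite_basis[OF that] disj
          card_Un_disjoint[of "Y \<inter> P True" "Y \<inter> P False"] by (metis finite_Int inf_assoc inf_bot_right inf_left_commute)
      then show ?thesis using tot by (auto simp: P_def)
    qed
    then have "{Y \<in> B. {} \<subseteq> Y \<and> (\<forall>c. card ((Y - {}) \<inter> P c) = count_list cs c)}
        = {Y \<in> B. card (Y \<inter> Q) = count_list cs False}"
      by (auto simp: all_bool_eq)
    then have "mixed G B {} (map (\<lambda>c i. of_bool (i \<in> P c)) cs)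
        = fact (count_list cs True) * fact (count_list cs False) * N (count_list cs False)"
      using mixed_indicator[of "{}" cs P] that disj cover by (simp add: N_def)
    moreover have "real (d choose count_list cs False)
        = fact d / (fact (count_list cs False) * fact (count_list cs True))"
      using binomial_fact[of "count_list cs False" d, where ?'a = real] tot
      by (metis add_diff_cancel_right' le_add2)
    ultimately show ?thesis by simp
  qed
  \<comment> \<open>Two positions stay open: filling them with two, one or no entries
    \<open>False\<close> gives \<open>k + 1\<close>, \<open>k\<close> or \<open>k - 1\<close>
    elements of \<open>Q\<close>.\<close>
  define cs where "cs = replicate (d - k - 1) True @ replicate (k - 1) False"
  have len: "length cs + 2 = d" using True assms(2) by (simp add: cs_def)
  have "count_list (replicate n x) y = (if x = y then n else 0)" for n and x y :: bool
    by (induction n) auto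
  then have cnt: "count_list cs False = k - 1" by (simp add: cs_def)
  let ?r = "\<lambda>k. N k / (d choose k)"
  have "fact d * ?r (k - 1) * (fact d * ?r (k + 1)) \<le> (fact d * ?r k)\<^sup>2"
  proof -
    have "mixed G B {} (map (\<lambda>c i. of_bool (i \<in> P c)) (True # True # cs)) = fact d * ?r (k - 1)"
      and "mixed G B {} (map (\<lambda>c i. of_bool (i \<in> P c)) (False # False # cs)) = fact d * ?r (k + 1)"
      and "mixed G B {} (map (\<lambda>c i. of_bool (i \<in> P c)) (True # False # cs)) = fact d * ?r k"
      using eval[of "True # True # cs"] eval[of "False # False # cs"] eval[of "True # False # cs"]
        len cnt assms(2) by (simp_all del: mixed.simps list.map)
    then show ?thesis
      using indicator_alexandrov_fenchel[OF len disj cover] by (simp del: mixed.simps list.map)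
  qed
  then have "(fact d)\<^sup>2 * (?r (k + 1) * ?r (k - 1)) \<le> (fact d)\<^sup>2 * (?r k)\<^sup>2"
    by (simp add: power2_eq_square mult_ac)
  then have "?r (k + 1) * ?r (k - 1) \<le> (?r k)\<^sup>2"
    by (rule mult_left_le_imp_le) simp
  then show ?thesis by (simp add: power_divide)
qed

end

section \<open>The matroid of a bimatroid\<close>

text \<open>For a matrix these are the column bases of the identity extended by the matrix, the
  maximal minors being, up to sign, the minors at \<open>(I, J)\<close>. In general, removing a row
  element enlarges \<open>I\<close> and removing a column element shrinks \<open>J\<close>, so the
  two exchange axioms are the two cases of basis exchange.\<close>

lemma bimatroid_matroid_bases:
  fixes E :: "'a set" and F :: "'b set"
  assumes "finite E" "finite F" "bimatroid E F R"
  shows "matroid_bases (Inl ` E \<union> Inr ` F) ((\<lambda>(I, J). Inl ` (E - I) \<union> Inr ` J) ` R) (card E)"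
proof
  have R: "I \<subseteq> E" "J \<subseteq> F" "card I = card J" if "(I, J) \<in> R" for I J
    using that assms(3) by (auto simp: bimatroid_def equicard_pairs_def nsets_def)
  let ?b = "\<lambda>(I, J). Inl ` (E - I) \<union> Inr ` J"
  show "finite (Inl ` E \<union> Inr ` F)" using assms by simp
  show "?b ` R \<noteq> {}" using assms(3) by (auto simp: bimatroid_def)
  fix Y assume "Y \<in> ?b ` R"
  then obtain I J where Y: "Y = Inl ` (E - I) \<union> Inr ` J" and IJ: "(I, J) \<in> R" by auto
  show "Y \<subseteq> Inl ` E \<union> Inr ` F" using Y R[OF IJ] by auto
  have fin: "finite I" "finite J" using R[OF IJ] assms finite_subset by blast+
  have "card Y = card (Inl ` (E - I) :: ('a + 'b) set) + card (Inr ` J :: ('a + 'b) set)"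
    unfolding Y using assms fin by (intro card_Un_disjoint) auto
  also have "\<dots> = card E - card I + card J"
    using R[OF IJ] fin by (simp add: card_image card_Diff_subset)
  finally show "card Y = card E"
    using R[OF IJ] card_mono[OF assms(1) R(1)[OF IJ]] by simp
  fix Z x assume "Z \<in> ?b ` R" and x: "x \<in> Y - Z"
  then obtain I' J' where Z: "Z = Inl ` (E - I') \<union> Inr ` J'" and IJ': "(I', J') \<in> R" by auto
  have ax: "(\<forall>i' \<in> I' - I. (\<exists>i \<in> I - I'. (exchange I i i', J) \<in> R) \<or>
           (\<exists>j' \<in> J' - J. (I \<union> {i'}, J \<union> {j'}) \<in> R)) \<and>
        (\<forall>j \<in> J - J'. (\<exists>j' \<in> J' - J. (I, exchange J j j') \<in> R) \<or>
           (\<exists>i \<in> I - I'. (I - {i}, J - {j}) \<in> R))"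
    using assms(3) IJ IJ' unfolding bimatroid_def by blast
  consider i' where "x = Inl i'" "i' \<in> I' - I" | j where "x = Inr j" "j \<in> J - J'"
    using x unfolding Y Z by auto
  then show "\<exists>y\<in>Z - Y. insert y (Y - {x}) \<in> ?b ` R"
  proof cases
    case 1
    with ax consider i where "i \<in> I - I'" "(exchange I i i', J) \<in> R"
      | j' where "j' \<in> J' - J" "(I \<union> {i'}, J \<union> {j'}) \<in> R" by blast
    then show ?thesis
    proof cases
      case (1 i)
      have eq: "insert (Inl i) (Y - {x}) = ?b (exchange I i i', J)"
        using 1 \<open>x = Inl i'\<close> \<open>i' \<in> I' - I\<close> R[OF IJ] unfolding Y exchange_def by auto
      have "Inl i \<in> Z - Y" using 1 R[OF IJ] unfolding Y Z by auto
      then show ?thesis by (rule bexI[rotated]) (rule image_eqI[where f = ?b, OF eq 1(2)])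
    next
      case (2 j')
      have eq: "insert (Inr j') (Y - {x}) = ?b (I \<union> {i'}, J \<union> {j'})"
        using \<open>x = Inl i'\<close> unfolding Y by auto
      have "Inr j' \<in> Z - Y" using 2 unfolding Y Z by auto
      then show ?thesis by (rule bexI[rotated]) (rule image_eqI[where f = ?b, OF eq 2(2)])
    qed
  next
    case 2
    with ax consider j' where "j' \<in> J' - J" "(I, exchange J j j') \<in> R"
      | i where "i \<in> I - I'" "(I - {i}, J - {j}) \<in> R" by blast
    then show ?thesis
    proof cases
      case (1 j')
      have eq: "insert (Inr j') (Y - {x}) = ?b (I, exchange J j j')"
        using \<open>x = Inr j\<close> unfolding Y exchange_def by auto
      have "Inr j' \<in> Z - Y" using 1 unfolding Y Z by auto
      then show ?thesis by (rule bexI[rotated]) (rule image_eqI[where f = ?b, OF eq 1(2)])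
    next
      case (2 i)
      have eq: "insert (Inl i) (Y - {x}) = ?b (I - {i}, J - {j})"
        using 2 \<open>x = Inr j\<close> R[OF IJ] unfolding Y by auto
      have "Inl i \<in> Z - Y" using 2 R[OF IJ] unfolding Y Z by auto
      then show ?thesis by (rule bexI[rotated]) (rule image_eqI[where f = ?b, OF eq 2(2)])
    qed
  qed
qed

text \<open>The encoding \<open>b\<close> is left general in order to serve both the matroid and its
  dual.\<close>

lemma card_bases_num_regular_minors:
  assumes "inj_on b R" "\<And>I J. (I, J) \<in> R \<Longrightarrow> card (b (I, J) \<inter> Q) = card I"
    and "\<And>I J. (I, J) \<in> R \<Longrightarrow> card I = card J"
  shows "card {Y \<in> b ` R. card (Y \<inter> Q) = k} = num_regular_minors R k"
proof -
  have "{Y \<in> b ` R. card (Y \<inter> Q) = k} = b ` {(I, J). (I, J) \<in> R \<and> card I = k \<and> card J = k}"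
    using assms(2,3) by (auto simp: image_iff)
  moreover have "inj_on b {(I, J). (I, J) \<in> R \<and> card I = k \<and> card J = k}"
    using assms(1) by (rule inj_on_subset) auto
  ultimately show ?thesis by (simp add: num_regular_minors_def card_image)
qed

theorem theoremA:
  fixes E :: "'a set" and F :: "'b set" and A :: "('a set \<times> 'b set) set"
    and m n k :: nat
  assumes "finite E" and "finite F"
    and "bimatroid E F A"
    and "m = card E" and "n = card F"
    and "k \<ge> 1"
  shows "(real (num_regular_minors A k))\<^sup>2 / (real (min m n choose k))\<^sup>2
       \<ge> (real (num_regular_minors A (k + 1)) / real (min m n choose (k + 1)))
         * (real (num_regular_minors A (k - 1)) / real (min m n choose (k - 1)))"
proof -
  let ?G = "Inl ` E \<union> Inr ` F :: ('a + 'b) set"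
  let ?b = "\<lambda>(I, J). Inl ` (E - I) \<union> Inr ` J :: ('a + 'b) set"
  let ?b' = "\<lambda>(I, J). Inl ` I \<union> Inr ` (F - J) :: ('a + 'b) set"
  have A: "I \<subseteq> E" "J \<subseteq> F" "card I = card J" if "(I, J) \<in> A" for I J
    using that assms(3) by (auto simp: bimatroid_def equicard_pairs_def nsets_def)
  interpret M: matroid_bases ?G "?b ` A" "card E"
    by (rule bimatroid_matroid_bases[OF assms(1-3)])
  show ?thesis
  \<comment> \<open>The matroid or its dual is chosen so that the rank is \<open>min m n\<close>.
    Correspondingly \<open>Q\<close> is the set of columns or of rows, and meets the basis of
    \<open>(I, J)\<close> in \<open>J\<close> or \<open>I\<close>, which have equal size.\<close>
  proof (cases "m \<le> n")
    case True
    have "inj_on ?b A"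
    proof (rule inj_onI, clarify)
      fix I J I' J' assume "(I, J) \<in> A" "(I', J') \<in> A"
        and eq: "Inl ` (E - I) \<union> Inr ` J = (Inl ` (E - I') \<union> Inr ` J' :: ('a + 'b) set)"
      moreover have "E - I = E - I'" "J = J'" using eq by blast+
      ultimately show "I = I' \<and> J = J'" using A(1)[of I J] A(1)[of I' J'] by blast
    qed
    moreover have "card (?b (I, J) \<inter> Inr ` F) = card I" if "(I, J) \<in> A" for I J
    proof -
      have "?b (I, J) \<inter> Inr ` F = Inr ` J" using A(2)[OF that] by auto
      then show ?thesis using A(3)[OF that] by (simp add: card_image)
    qed
    ultimately have "card {Y \<in> ?b ` A. card (Y \<inter> Inr ` F) = k} = num_regular_minors A k" for k
      using A(3) by (intro card_bases_num_regular_minors) auto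
    then show ?thesis
      using M.bases_ultra_log_concave[of "Inr ` F" k] assms True by (simp add: min_absorb1)
  next
    case False
    have cardG: "card ?G - card E = card F"
      using assms by (subst card_Un_disjoint) (auto simp: card_image)
    have dual: "(\<lambda>Y. ?G - Y) ` ?b ` A = ?b' ` A"
      unfolding image_image
    proof (rule image_cong[OF refl], clarify)
      fix I J assume "(I, J) \<in> A"
      then show "?G - (Inl ` (E - I) \<union> Inr ` J) = Inl ` I \<union> Inr ` (F - J)"
        using A[of I J] by auto
    qed
    interpret D: matroid_bases ?G "?b' ` A" "card F"
      using M.dual_bases unfolding dual cardG .
    have "inj_on ?b' A"
    proof (rule inj_onI, clarify)
      fix I J I' J' assume "(I, J) \<in> A" "(I', J') \<in> A"
        and eq: "Inl ` I \<union> Inr ` (F - J) = (Inl ` I' \<union> Inr ` (F - J') :: ('a + 'b) set)"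
      moreover have "I = I'" "F - J = F - J'" using eq by blast+
      ultimately show "I = I' \<and> J = J'" using A(2)[of I J] A(2)[of I' J'] by blast
    qed
    moreover have "card (?b' (I, J) \<inter> Inl ` E) = card I" if "(I, J) \<in> A" for I J
    proof -
      have "?b' (I, J) \<inter> Inl ` E = Inl ` I" using A(1)[OF that] by auto
      then show ?thesis by (simp add: card_image)
    qed
    ultimately have "card {Y \<in> ?b' ` A. card (Y \<inter> Inl ` E) = k} = num_regular_minors A k" for k
      using A(3) by (intro card_bases_num_regular_minors) auto
    then show ?thesis
      using D.bases_ultra_log_concave[of "Inl ` E" k] assms False by (simp add: min_absorb2)
  qed
qed

end
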